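(* Let $k$ and $r$ be two integers with $k \ge 2$ and $k \ge r \ge 1$, and let $G$ be an undirected graph that contains no cycle whose length is congruent to $r$ modulo $k$. If $r \ne 2$, then $G$ is $k$-colorable; if $r = 2$, then $G$ is $(k+1)$-colorable.
   Context: Undirected graphs are finite and simple (no loops, no multiple edges). Cycles in undirected graphs are the usual simple cycles, so they have length at least $3$; the length of a cycle is its number of edges. A graph is $m$-colorable if it admits a proper vertex coloring with $m$ colors. *)

theory Defs
  imports "Graph_Theory.Pair_Digraph" "HOL-Number_Theory.Cong"
begin

(* A finite simple undirected graph is a pair_graph: a finite vertex set together with a
   symmetric, loop-free relation on it, so that an undirected edge {u, v} is represented by
   the two arcs (u, v) and (v, u). *)

(* A list of arcs, traversing the cycle in one direction; its length is the number of edges.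
   The library's cycle also admits the back-and-forth walk [(u, v), (v, u)], which uses a
   single undirected edge twice; the length bound excludes exactly these. *)
definition undirected_cycle :: "'a pair_pre_digraph \<Rightarrow> ('a \<times> 'a) list \<Rightarrow> bool" where
  "undirected_cycle G p \<longleftrightarrow> pre_digraph.cycle (with_proj G) p \<and> 3 \<le> length p"

definition proper_coloring :: "'a pair_pre_digraph \<Rightarrow> ('a \<Rightarrow> 'c) \<Rightarrow> bool" where
  "proper_coloring G c \<longleftrightarrow> (\<forall>(u, v) \<in> parcs G. c u \<noteq> c v)"

definition colorable :: "nat \<Rightarrow> 'a pair_pre_digraph \<Rightarrow> bool" where
  "colorable m G \<longleftrightarrow> (\<exists>c :: 'a \<Rightarrow> nat. c ` pverts G \<subseteq> {..<m} \<and> proper_coloring G c)"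

end

theory Submission
  imports Defs "HOL-Library.Transitive_Closure_Table"
begin

text \<open>
  Both bounds come from coloring the graph one vertex at a time.

  Let \<open>r \<noteq> 2\<close>. Put \<open>j = r - 2\<close> modulo \<open>k\<close>, a color different from \<open>0\<close>, and suppose that everything
  but a vertex \<open>v\<close> is properly colored with \<open>0, \<dots>, k - 1\<close>. Orient an edge from \<open>x\<close> to \<open>y\<close> when the
  color of \<open>y\<close> is the successor, modulo \<open>k\<close>, of the color of \<open>x\<close>, and let \<open>R\<close> consist of all
  vertices reachable from the neighbors of \<open>v\<close> with color \<open>0\<close>. Since no oriented edge leaves \<open>R\<close>,
  raising all colors on \<open>R\<close> by one keeps the coloring proper. A neighbor of \<open>v\<close> with color \<open>j\<close> cannot
  lie in \<open>R\<close>: an oriented path to it from a neighbor with color \<open>0\<close> has length \<open>j\<close> modulo \<open>k\<close>,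
  and it would close through \<open>v\<close> to a cycle of length \<open>j + 2\<close>, which is \<open>r\<close> modulo \<open>k\<close>. So
  neighbors with color \<open>j\<close> never move, the other ones only advance cyclically towards \<open>j\<close>, and those
  with color \<open>0\<close> do advance. After finitely many rounds color \<open>0\<close> is free for \<open>v\<close>
  (\<open>ex_coloring_avoiding_color_0\<close>).

  Let \<open>r = 2\<close>. All neighbors of an end vertex \<open>v\<close> of a longest path lie on that path. If there were
  more than \<open>k\<close> of them, two would have positions congruent modulo \<open>k\<close>, and the segment between these two
  would close through \<open>v\<close> to a cycle of length \<open>2\<close> modulo \<open>k\<close>. Hence every nonempty induced subgraph has a
  vertex of degree at most \<open>k\<close> (\<open>ex_low_degree_vertex\<close>), and greedy coloring needs only
  \<open>k + 1\<close> colors.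
\<close>

section \<open>Cycles and colorings of a relation\<close>

text \<open>
  The list \<open>xs\<close> omits the starting vertex of the closed path and contains it as its last entry, so
  that distinctness of \<open>xs\<close> is exactly simplicity and the length of \<open>xs\<close> is the number of edges.
\<close>
definition cycle_of_length :: "('a \<Rightarrow> 'a \<Rightarrow> bool) \<Rightarrow> nat \<Rightarrow> bool" where
  "cycle_of_length E n \<longleftrightarrow>
     3 \<le> n \<and> (\<exists>v xs. rtrancl_path E v xs v \<and> distinct xs \<and> length xs = n)"

definition coloring_on :: "('a \<Rightarrow> 'a \<Rightarrow> bool) \<Rightarrow> nat \<Rightarrow> 'a set \<Rightarrow> ('a \<Rightarrow> nat) \<Rightarrow> bool" where
  "coloring_on E m V c \<longleftrightarrow>
     (\<forall>x\<in>V. c x < m) \<and> (\<forall>x\<in>V. \<forall>y\<in>V. E x y \<longrightarrow> c x \<noteq> c y)"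

lemma rtrancl_path_mono_rel:
  assumes "rtrancl_path r x xs y" and "\<And>u v. r u v \<Longrightarrow> s u v"
  shows "rtrancl_path s x xs y"
  using assms(1) by induction (auto intro: rtrancl_path.intros assms(2))

lemma cycle_of_length_closing_path:
  assumes path: "rtrancl_path E a xs b"
    and "E v a" and "E b v"
    and "distinct (a # xs)" and "v \<notin> set (a # xs)" and "xs \<noteq> []"
  shows "cycle_of_length E (length xs + 2)"
proof -
  have "rtrancl_path E b [v] v"
    using \<open>E b v\<close> by (intro rtrancl_path.intros)
  then have "rtrancl_path E v (a # (xs @ [v])) v"
    using rtrancl_path.step[of E, OF \<open>E v a\<close>] rtrancl_path_trans[OF path] by blast
  moreover have "distinct (a # (xs @ [v]))"
    using assms by auto
  moreover have "3 \<le> length xs + 2"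
    using \<open>xs \<noteq> []\<close> by (cases xs) auto
  ultimately show ?thesis
    unfolding cycle_of_length_def by (auto intro!: exI[of _ v] exI[of _ "a # (xs @ [v])"])
qed

lemma coloring_on_insert:
  assumes col: "coloring_on E m V c" and "symp E" and "irreflp E" and "i < m"
    and free: "\<And>u. u \<in> V \<Longrightarrow> E v u \<Longrightarrow> c u \<noteq> i"
  shows "\<exists>c. coloring_on E m (insert v V) c"
proof -
  have free': "c u \<noteq> i" if "u \<in> V" "E u v" for u
    using free[OF that(1)] sympD[OF \<open>symp E\<close> that(2)] by blast
  have "\<not> E v v"
    using \<open>irreflp E\<close> by (rule irreflpD)
  then have "coloring_on E m (insert v V) (c(v := i))"
    using col \<open>i < m\<close> unfolding coloring_on_def by (auto dest: free free')
  then show ?thesis by blast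
qed

section \<open>Rotating colors away from a vertex\<close>

text \<open>
  Along a path on which each step raises the color by one, the colors at the two ends determine the
  length modulo \<open>k\<close>; this is how colors control cycle lengths.
\<close>
lemma rtrancl_path_color_increment:
  assumes "rtrancl_path (\<lambda>x y. H x y \<and> c y = (c x + 1) mod k) x xs y"
  shows "[c y = c x + length xs] (mod k)"
  using assms
proof induction
  case (base x)
  then show ?case by simp
next
  case (step x y ys z)
  then have "[c y = c x + 1] (mod k)"
    by (auto simp: cong_def)
  then have "[c y + length ys = c x + 1 + length ys] (mod k)"
    by (rule cong_add) simp
  with step.IH have "[c z = c x + 1 + length ys] (mod k)"
    by (rule cong_trans)
  then show ?case by simp
qed

text \<open>
  Raising the colors of \<open>R\<close> by one can create a conflict only on an edge that leaves \<open>R\<close> towards a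
  vertex already carrying the raised color, and closedness of \<open>R\<close> forbids such an edge.
\<close>
lemma coloring_on_shift:
  assumes col: "coloring_on E k V c" and "symp E" and "0 < k"
    and closed: "\<And>x y. x \<in> R \<Longrightarrow> x \<in> V \<Longrightarrow> y \<in> V \<Longrightarrow> E x y \<Longrightarrow> c y = (c x + 1) mod k \<Longrightarrow> y \<in> R"
  shows "coloring_on E k V (\<lambda>x. if x \<in> R then (c x + 1) mod k else c x)"
proof -
  let ?c = "\<lambda>x. if x \<in> R then (c x + 1) mod k else c x"
  have less: "c x < k" if "x \<in> V" for x
    using col that by (auto simp: coloring_on_def)
  have neq: "c x \<noteq> c y" if "x \<in> V" "y \<in> V" "E x y" for x y
    using col that by (auto simp: coloring_on_def)
  have sym: "E y x" if "E x y" for x y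
    using \<open>symp E\<close> that by (rule sympD)
  have inj: "(a + 1) mod k \<noteq> (b + 1) mod k" if "a < k" "b < k" "a \<noteq> b" for a b
    using that by (auto simp: mod_Suc split: if_splits)
  have "?c x \<noteq> ?c y" if xy: "x \<in> V" "y \<in> V" "E x y" for x y
  proof (cases "x \<in> R"; cases "y \<in> R")
    assume "x \<in> R" "y \<in> R"
    then show ?thesis using inj[OF less less neq] xy by auto
  next
    assume "x \<in> R" "y \<notin> R"
    then show ?thesis using closed[of x y] xy by auto
  next
    assume "x \<notin> R" "y \<in> R"
    then show ?thesis using closed[of y x] xy sym by auto
  next
    assume "x \<notin> R" "y \<notin> R"
    then show ?thesis using neq xy by auto
  qed
  then show ?thesis
    unfolding coloring_on_def using less \<open>0 < k\<close> by auto
qed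

text \<open>
  The number of upward steps, modulo \<open>k\<close>, from a color to the target \<open>j\<close> drops with each step
  not starting at \<open>j\<close> itself. The summand \<open>k\<close> avoids truncated subtraction.
\<close>
lemma mod_distance_decreases:
  fixes a j k :: nat
  assumes "a < k" and "j < k" and "a \<noteq> j"
  shows "(j + k - (a + 1) mod k) mod k < (j + k - a) mod k"
proof -
  consider "a < j" | "j < a" "a + 1 < k" | "j < a" "a + 1 = k"
    using assms by linarith
  then show ?thesis
  proof cases
    case 1
    have wrap: "(j + k - b) mod k = j - b" if "b \<le> j" for b
      using that \<open>j < k\<close> by (metis Nat.add_diff_assoc2 less_imp_diff_less mod_add_self2 mod_less)
    have "a + 1 < k"
      using 1 \<open>j < k\<close> by simp
    then show ?thesis
      using wrap[of a] wrap[of "a + 1"] 1 by simp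
  next
    case 2
    then have "j + k - a < k" "j + k - (a + 1) < j + k - a"
      by auto
    with 2 show ?thesis by simp
  next
    case 3
    with assms show ?thesis by simp
  qed
qed

text \<open>
  Among all colorings, one minimizing the total distance of the colors of the neighbors of \<open>v\<close> from
  \<open>j\<close> leaves no neighbor with color \<open>0\<close>: otherwise shifting the part reachable from those neighbors
  would decrease the total, as the neighbors with color \<open>j\<close> stay in place.
\<close>
lemma ex_coloring_avoiding_color_0:
  fixes j k r :: nat
  assumes "symp E" and "finite V" and "v \<notin> V"
    and "0 < j" and "j < k" and "[j + 2 = r] (mod k)"
    and no_cycle: "\<And>n. [n = r] (mod k) \<Longrightarrow> \<not> cycle_of_length E n"
    and "coloring_on E k V c"
  shows "\<exists>c. coloring_on E k V c \<and> (\<forall>u\<in>V. E v u \<longrightarrow> c u \<noteq> 0)"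
proof -
  define N where "N = {u \<in> V. E v u}"
  define pot where "pot c = (\<Sum>u\<in>N. (j + k - c u) mod k)" for c :: "'a \<Rightarrow> nat"
  have "finite N"
    using \<open>finite V\<close> by (simp add: N_def)
  have "\<exists>c. coloring_on E k V c \<and> (\<forall>d. coloring_on E k V d \<longrightarrow> pot c \<le> pot d)"
    using ex_has_least_nat[of "coloring_on E k V" c pot] assms by blast
  then obtain c where col: "coloring_on E k V c"
    and least: "\<And>d. coloring_on E k V d \<Longrightarrow> pot c \<le> pot d"
    by blast
  have "c u \<noteq> 0" if "u \<in> N" for u
  proof
    assume "c u = 0"
    define H where "H = (\<lambda>x y. (E x y \<and> x \<in> V \<and> y \<in> V) \<and> c y = (c x + 1) mod k)"
    define R where "R = {y. \<exists>a\<in>N. c a = 0 \<and> H\<^sup>*\<^sup>* a y}"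
    define d where "d x = (if x \<in> R then (c x + 1) mod k else c x)" for x
    have "coloring_on E k V d"
      unfolding d_def using col \<open>symp E\<close>
    proof (rule coloring_on_shift)
      show "0 < k" using \<open>j < k\<close> by simp
      show "y \<in> R" if "x \<in> R" "x \<in> V" "y \<in> V" "E x y" "c y = (c x + 1) mod k" for x y
        using that unfolding R_def
        by (auto intro!: rtranclp.rtrancl_into_rtrancl simp: H_def)
    qed
    have j_fixed: "b \<notin> R" if "b \<in> N" "c b = j" for b
    proof
      assume "b \<in> R"
      then obtain a where a: "a \<in> N" "c a = 0" "H\<^sup>*\<^sup>* a b"
        by (auto simp: R_def)
      then obtain xs0 where "rtrancl_path H a xs0 b"
        by (auto simp: rtranclp_eq_rtrancl_path)
      then obtain xs where path: "rtrancl_path H a xs b" and dist: "distinct (a # xs)"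
        by (rule rtrancl_path_distinct)
      have "xs \<noteq> []"
        using path a that \<open>0 < j\<close> by (auto elim: rtrancl_path.cases)
      have "set xs \<subseteq> V"
        using rtrancl_path_Range[OF path] by (auto simp: H_def)
      then have "v \<notin> set (a # xs)"
        using a \<open>v \<notin> V\<close> by (auto simp: N_def)
      have "rtrancl_path E a xs b"
        using path by (rule rtrancl_path_mono_rel) (simp add: H_def)
      moreover have "E v a" "E b v"
        using a that sympD[OF \<open>symp E\<close>, of v b] by (auto simp: N_def)
      ultimately have "cycle_of_length E (length xs + 2)"
        using dist \<open>v \<notin> set (a # xs)\<close> \<open>xs \<noteq> []\<close> by (intro cycle_of_length_closing_path)
      moreover have "[j = length xs] (mod k)"
        using rtrancl_path_color_increment[OF path[unfolded H_def]] a that by simp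
      then have "[length xs + 2 = j + 2] (mod k)"
        by (intro cong_add) (simp_all add: cong_sym)
      then have "[length xs + 2 = r] (mod k)"
        using \<open>[j + 2 = r] (mod k)\<close> by (rule cong_trans)
      ultimately show False
        using no_cycle by blast
    qed
    have less: "(j + k - d x) mod k < (j + k - c x) mod k" if "x \<in> N" "x \<in> R" for x
    proof -
      have "c x < k" "c x \<noteq> j"
        using that j_fixed col by (auto simp: coloring_on_def N_def)
      then show ?thesis
        using mod_distance_decreases[of "c x" k j] \<open>j < k\<close> that by (simp add: d_def)
    qed
    have "u \<in> R"
      using that \<open>c u = 0\<close> by (auto simp: R_def)
    have "pot d < pot c"
      unfolding pot_def
    proof (rule sum_strict_mono_ex1[OF \<open>finite N\<close>])
      show "\<forall>x\<in>N. (j + k - d x) mod k \<le> (j + k - c x) mod k"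
        using less by (metis d_def less_imp_le order_refl)
      show "\<exists>x\<in>N. (j + k - d x) mod k < (j + k - c x) mod k"
        using less that \<open>u \<in> R\<close> by blast
    qed
    then show False
      using least[OF \<open>coloring_on E k V d\<close>] by simp
  qed
  then show ?thesis
    using col by (auto simp: N_def)
qed

lemma ex_coloring_no_cycle_mod:
  fixes j k r :: nat
  assumes "symp E" and "irreflp E" and "finite V"
    and "0 < j" and "j < k" and "[j + 2 = r] (mod k)"
    and no_cycle: "\<And>n. [n = r] (mod k) \<Longrightarrow> \<not> cycle_of_length E n"
  shows "\<exists>c. coloring_on E k V c"
  using \<open>finite V\<close>
proof induction
  case empty
  show ?case by (simp add: coloring_on_def)
next
  case (insert v V)
  then obtain c0 where "coloring_on E k V c0" by blast
  then obtain c where "coloring_on E k V c" "\<forall>u\<in>V. E v u \<longrightarrow> c u \<noteq> 0"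
    using ex_coloring_avoiding_color_0[OF \<open>symp E\<close> insert.hyps(1,2) assms(4-6) no_cycle] by blast
  then show ?case
    using coloring_on_insert[OF _ \<open>symp E\<close> \<open>irreflp E\<close>, of k V c 0 v] \<open>j < k\<close> by auto
qed

section \<open>Cycles of length 2 modulo k\<close>

text \<open>
  Positions along a longest path starting at \<open>v\<close> are counted modulo \<open>k\<close>: two neighbors of \<open>v\<close> at
  congruent positions close the segment between them to a forbidden cycle, so the neighbors of \<open>v\<close>
  occupy different residue classes.
\<close>
lemma ex_low_degree_vertex:
  assumes "symp E" and "irreflp E" and "finite V" and "V \<noteq> {}" and "0 < k"
    and no_cycle: "\<And>n. [n = 2] (mod k) \<Longrightarrow> \<not> cycle_of_length E n"
  shows "\<exists>v\<in>V. card {u \<in> V. E v u} \<le> k"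
proof -
  \<comment> \<open>A pair \<open>(v, xs)\<close> stands for the path that starts at \<open>v\<close> and continues along \<open>xs\<close>.\<close>
  define P where "P = (\<lambda>(v, xs). set (v # xs) \<subseteq> V \<and> distinct (v # xs) \<and> (\<exists>y. rtrancl_path E v xs y))"
  obtain v0 where "v0 \<in> V" using \<open>V \<noteq> {}\<close> by blast
  then have P0: "P (v0, [])"
    by (auto simp: P_def intro: rtrancl_path.base)
  have bound: "length (snd q) < Suc (card V)" if "P q" for q
  proof -
    have "distinct (snd q)" "set (snd q) \<subseteq> V"
      using that by (auto simp: P_def split: prod.splits)
    then show ?thesis
      using card_mono[OF \<open>finite V\<close>] distinct_card by (metis less_Suc_eq_le)
  qed
  obtain q where q: "P q" "\<And>q'. P q' \<Longrightarrow> length (snd q') \<le> length (snd q)"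
    using ex_has_greatest_nat[of P "(v0, [])" "\<lambda>q. length (snd q)" "Suc (card V)"] P0 bound
    by blast
  obtain v xs where [simp]: "q = (v, xs)" by (cases q)
  have sub: "set (v # xs) \<subseteq> V" and dist: "distinct (v # xs)"
    using q(1) by (auto simp: P_def)
  obtain y where path: "rtrancl_path E v xs y"
    using q(1) by (auto simp: P_def)
  \<comment> \<open>A neighbor of \<open>v\<close> off the path could be prepended to it.\<close>
  have nbrs: "u \<in> set xs" if u: "u \<in> V" "E v u" for u
  proof (rule ccontr)
    assume "u \<notin> set xs"
    moreover have "u \<noteq> v"
      using u irreflpD[OF \<open>irreflp E\<close>] by blast
    moreover have "rtrancl_path E u (v # xs) y"
      using rtrancl_path.step[of E, OF sympD[OF \<open>symp E\<close> u(2)] path] .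
    ultimately have "P (u, v # xs)"
      using sub dist u by (auto simp: P_def)
    from q(2)[OF this] show False by simp
  qed
  define I where "I = {i. i < length xs \<and> E v (xs ! i)}"
  have "finite I" by (simp add: I_def)
  have "{u \<in> V. E v u} \<subseteq> (!) xs ` I"
    using nbrs by (auto simp: I_def in_set_conv_nth)
  then have "card {u \<in> V. E v u} \<le> card I"
    using \<open>finite I\<close> by (rule surj_card_le[rotated])
  also have "card I \<le> k"
  proof (rule ccontr)
    assume "\<not> card I \<le> k"
    moreover have "(\<lambda>i. i mod k) ` I \<subseteq> {..<k}"
      using \<open>0 < k\<close> by auto
    then have "card ((\<lambda>i. i mod k) ` I) \<le> k"
      using card_mono[of "{..<k}"] by fastforce
    ultimately have "\<not> inj_on (\<lambda>i. i mod k) I"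
      by (auto dest: card_image)
    then obtain i j where "i \<in> I" "j \<in> I" "i \<noteq> j" "i mod k = j mod k"
      by (auto simp: inj_on_def)
    then obtain i j where ij: "i \<in> I" "j \<in> I" "i < j" "i mod k = j mod k"
      by (metis nat_neq_iff)
    \<comment> \<open>The part of the path after position \<open>i\<close>, up to and including position \<open>j\<close>.\<close>
    define ys where "ys = take (j - i) (drop (Suc i) xs)"
    have "j < length xs" using ij by (simp add: I_def)
    have len: "length ys = j - i"
      using ij \<open>j < length xs\<close> by (simp add: ys_def)
    then have "ys \<noteq> []" using ij by auto
    have "last ys = xs ! j"
      using len ij \<open>ys \<noteq> []\<close> \<open>j < length xs\<close> by (simp add: last_conv_nth ys_def)
    obtain zs where "drop (Suc i) xs = ys @ zs"
      unfolding ys_def by (metis append_take_drop_id)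
    then have split: "xs = take i xs @ xs ! i # ys @ zs"
      using id_take_nth_drop[of i xs] ij \<open>j < length xs\<close> by simp
    have "distinct (v # take i xs @ xs ! i # ys @ zs)"
      using dist by (subst split[symmetric])
    then have "distinct (xs ! i # ys)" "v \<notin> set (xs ! i # ys)"
      by auto
    have "rtrancl_path E v (take i xs @ xs ! i # ys @ zs) y"
      using path by (subst split[symmetric])
    then have "rtrancl_path E (xs ! i) (ys @ zs) y"
      by (rule rtrancl_path_appendE)
    moreover have "ys @ zs = butlast ys @ xs ! j # zs"
      using \<open>ys \<noteq> []\<close> \<open>last ys = xs ! j\<close> append_butlast_last_id[of ys]
      by (metis append.assoc append_Cons append_Nil)
    ultimately have "rtrancl_path E (xs ! i) (butlast ys @ [xs ! j]) (xs ! j)"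
      by (metis rtrancl_path_appendE)
    then have "rtrancl_path E (xs ! i) ys (xs ! j)"
      using \<open>ys \<noteq> []\<close> \<open>last ys = xs ! j\<close> append_butlast_last_id[of ys] by simp
    moreover have "E v (xs ! i)" "E (xs ! j) v"
      using ij sympD[OF \<open>symp E\<close>, of v "xs ! j"] by (auto simp: I_def)
    ultimately have "cycle_of_length E (length ys + 2)"
      using \<open>distinct (xs ! i # ys)\<close> \<open>v \<notin> set (xs ! i # ys)\<close> \<open>ys \<noteq> []\<close>
      by (intro cycle_of_length_closing_path)
    moreover have "k dvd j - i"
      using ij mod_eq_dvd_iff_nat[of i j k] by simp
    then have "[length ys = 0] (mod k)"
      using len by (simp add: cong_0_iff)
    then have "[length ys + 2 = 2] (mod k)"
      using cong_add[of "length ys" 0 k 2 2] by (simp add: numeral_2_eq_2)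
    ultimately show False
      using no_cycle by blast
  qed
  finally show ?thesis
    using sub by auto
qed

lemma ex_coloring_no_cycle_2_mod:
  assumes "symp E" and "irreflp E" and "finite V" and "0 < k"
    and no_cycle: "\<And>n. [n = 2] (mod k) \<Longrightarrow> \<not> cycle_of_length E n"
  shows "\<exists>c. coloring_on E (k + 1) V c"
  using \<open>finite V\<close>
proof (induction rule: finite_psubset_induct)
  case (psubset V)
  show ?case
  proof (cases "V = {}")
    case True
    then show ?thesis by (simp add: coloring_on_def)
  next
    case False
    then obtain v where v: "v \<in> V" "card {u \<in> V. E v u} \<le> k"
      using ex_low_degree_vertex[OF assms(1,2) \<open>finite V\<close> _ \<open>0 < k\<close> no_cycle] by blast
    then obtain c where c: "coloring_on E (k + 1) (V - {v}) c"
      using psubset.IH[of "V - {v}"] by blast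
    have "card (c ` {u \<in> V. E v u}) < card {..<k + 1}"
      using card_image_le[of "{u \<in> V. E v u}" c] v \<open>finite V\<close> by simp
    then obtain i where "i < k + 1" "i \<notin> c ` {u \<in> V. E v u}"
      using card_mono[of "c ` {u \<in> V. E v u}" "{..<k + 1}"] \<open>finite V\<close> by fastforce
    then have "\<exists>c. coloring_on E (k + 1) (insert v (V - {v})) c"
      using coloring_on_insert[OF c assms(1,2), of i v] by fastforce
    then show ?thesis
      using v by (simp add: insert_absorb)
  qed
qed

section \<open>Transfer to graphs\<close>

lemma rtrancl_path_arcs:
  assumes "rtrancl_path (\<lambda>x y. (x, y) \<in> A) x xs y"
  shows "set (zip (x # xs) xs) \<subseteq> A"
    and "pcas x (zip (x # xs) xs) y"
    and "pawalk_verts x (zip (x # xs) xs) = x # xs"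
  using assms by induction auto

lemma (in pair_wf_digraph) undirected_cycle_of_length:
  assumes "cycle_of_length (\<lambda>x y. (x, y) \<in> parcs G) n"
  shows "\<exists>p. undirected_cycle G p \<and> length p = n"
proof -
  obtain v xs where path: "rtrancl_path (\<lambda>x y. (x, y) \<in> parcs G) v xs v"
    and xs: "distinct xs" "length xs = n" "3 \<le> n"
    using assms by (auto simp: cycle_of_length_def)
  let ?p = "zip (v # xs) xs"
  note arcs = rtrancl_path_arcs[OF path]
  have len: "length ?p = n"
    using xs by simp
  have "v \<in> pverts G"
    using path xs by cases (auto dest: in_arcsD1)
  then have "pre_digraph.cycle (with_proj G) ?p"
    unfolding pre_digraph.cycle_def pre_digraph.awalk_def
    using arcs xs len by (auto intro!: exI[of _ v])
  then show ?thesis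
    using len xs unfolding undirected_cycle_def by blast
qed

lemma colorable_if_coloring_on:
  assumes "pair_wf_digraph G" and "coloring_on (\<lambda>x y. (x, y) \<in> parcs G) m (pverts G) c"
  shows "colorable m G"
proof -
  interpret pair_wf_digraph G by fact
  show ?thesis
    using assms(2) unfolding colorable_def proper_coloring_def coloring_on_def
    by (intro exI[of _ c]) (auto dest: in_arcsD1 in_arcsD2)
qed

theorem theorem4:
  fixes k r :: nat and G :: "'a pair_pre_digraph"
  assumes "k \<ge> 2" and "k \<ge> r" and "r \<ge> 1"
    and "pair_graph G"
    and "\<not> (\<exists>p. undirected_cycle G p \<and> [length p = r] (mod k))"
  shows "(r \<noteq> 2 \<longrightarrow> colorable k G) \<and> (r = 2 \<longrightarrow> colorable (k + 1) G)"
proof -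
  interpret pair_graph G by fact
  define E where "E = (\<lambda>x y. (x, y) \<in> parcs G)"
  have "symp E"
    using pair_sym_arcs by (auto simp: E_def symmetric_def intro!: sympI dest: symD)
  have "irreflp E"
    unfolding E_def using pair_no_loops by (fastforce intro: irreflpI)
  have no_cycle: "\<not> cycle_of_length E n" if "[n = r] (mod k)" for n
    using that assms(5) undirected_cycle_of_length unfolding E_def by blast
  note colorable = colorable_if_coloring_on[OF pair_wf_digraph_axioms, folded E_def]
  have "colorable k G" if "r \<noteq> 2"
  proof -
    \<comment> \<open>The residue of \<open>r - 2\<close> modulo \<open>k\<close>, which is nonzero because \<open>r \<noteq> 2\<close>;
      for \<open>r = 1\<close> it wraps around to \<open>k - 1\<close>.\<close>
    define j where "j = (if r = 1 then k - 1 else r - 2)"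
    have "0 < j" "j < k"
      using assms(1-3) that by (auto simp: j_def)
    have "j + 2 = (if r = 1 then 1 + k else r)"
      using assms(1-3) by (auto simp: j_def)
    then have "[j + 2 = r] (mod k)"
      unfolding cong_def by (metis mod_add_self2)
    with \<open>0 < j\<close> \<open>j < k\<close> show ?thesis
      using ex_coloring_no_cycle_mod[OF \<open>symp E\<close> \<open>irreflp E\<close> pair_finite_verts _ _ _ no_cycle]
        colorable by blast
  qed
  moreover have "colorable (k + 1) G" if "r = 2"
  proof -
    have "0 < k" using assms(1) by simp
    then have "\<exists>c. coloring_on E (k + 1) (pverts G) c"
      using no_cycle that
      by (intro ex_coloring_no_cycle_2_mod[OF \<open>symp E\<close> \<open>irreflp E\<close> pair_finite_verts]) auto
    then show ?thesis using colorable by blast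
  qed
  ultimately show ?thesis by blast
qed

end
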